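(* Let $\lambda$ be a strongly compact cardinal. Then $\mathsf{CP}(\kappa,\theta)$ holds for every regular cardinal $\theta<\lambda$ and every regular cardinal $\kappa\geq\lambda$.
   Context: A cardinal $\lambda$ is strongly compact if for every $\kappa\geq\lambda$ there is a $\lambda$-complete ultrafilter on $[\kappa]^{<\lambda}$ (the family of subsets of $\kappa$ of size $<\lambda$) containing, for each $x\in[\kappa]^{<\lambda}$, the set $\{y\in[\kappa]^{<\lambda}:x\subseteq y\}$. For regular cardinals $\theta<\kappa$, a $\theta$-covering matrix for $\kappa$ is a family $\mathcal D=(K(\alpha,\beta):\alpha<\theta,\ \beta<\kappa)$ of subsets of $\kappa$ such that: (i) $\beta\subseteq\bigcup_{\alpha<\theta}K(\alpha,\beta)$ for all $\beta$; (ii) $|K(\alpha,\beta)|<\kappa$ for all $\alpha,\beta$; (iii) $K(\alpha,\beta)\subseteq K(\eta,\beta)$ whenever $\alpha<\eta<\theta$; (iv) for all $\gamma<\beta<\kappa$ and $\alpha<\theta$ there is $\eta<\theta$ with $K(\alpha,\gamma)\subseteq K(\eta,\beta)$; (v) for every $X\subseteq\kappa$ with $|X|\leq\theta$ there is $\gamma_X<\kappa$ such that for all $\beta<\kappa$ and $\eta<\theta$ there is $\alpha<\theta$ with $K(\eta,\beta)\cap X\subseteq K(\alpha,\gamma_X)$. For $A\subseteq\kappa$, $[A]^\theta$ denotes the family of subsets of $A$ of cardinality $\theta$; $[A]^\theta$ is covered by $\mathcal D$ if every $X\in[A]^\theta$ is contained in some $K(\alpha,\beta)$. $\mathsf{CP}(\kappa,\theta)$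 is the statement: for every $\theta$-covering matrix $\mathcal D$ for $\kappa$ there is an unbounded $A\subseteq\kappa$ such that $[A]^\theta$ is covered by $\mathcal D$. *)

theory Defs
  imports Main
begin

unbundle cardinal_syntax

text \<open>
  Following the library, a cardinal is a well-order \<open>r\<close> with \<open>Card_order r\<close>; its elements (the
  ordinals below it) are \<open>Field r\<close>, and the ordinal \<open>b \<in> Field r\<close>, seen as the set of its
  predecessors, is \<open>underS r b\<close>.
\<close>

text \<open>The conjunct \<open>cinfinite r\<close> is needed: \<open>regularCard\<close> also holds of finite cardinals.\<close>

definition regular_cardinal :: "'a rel \<Rightarrow> bool" where
  "regular_cardinal r \<longleftrightarrow> Cinfinite r \<and> regularCard r"

definition subsets_of_size_less :: "'a set \<Rightarrow> 'l rel \<Rightarrow> 'a set set" where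
  "subsets_of_size_less A l = {x. x \<subseteq> A \<and> |x| <o l}"

definition subsets_of_size :: "'a set \<Rightarrow> 't rel \<Rightarrow> 'a set set" where
  "subsets_of_size A t = {x. x \<subseteq> A \<and> |x| =o t}"

text \<open>
  An ultrafilter on a set \<open>S\<close> is a library filter concentrated on \<open>S\<close>; a set \<open>A\<close> belongs to it iff
  \<open>\<forall>\<^sub>F y in U. y \<in> A\<close>.
\<close>

definition ultrafilter_on :: "'s set \<Rightarrow> 's filter \<Rightarrow> bool" where
  "ultrafilter_on S U \<longleftrightarrow>
     U \<le> principal S \<and> U \<noteq> bot \<and>
     (\<forall>A. A \<subseteq> S \<longrightarrow> (\<forall>\<^sub>F y in U. y \<in> A) \<or> (\<forall>\<^sub>F y in U. y \<in> S - A))"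

definition complete_filter :: "'l rel \<Rightarrow> 's filter \<Rightarrow> bool" where
  "complete_filter l U \<longleftrightarrow>
     (\<forall>\<A>. |\<A>| <o l \<and> (\<forall>A\<in>\<A>. \<forall>\<^sub>F y in U. y \<in> A) \<longrightarrow> (\<forall>\<^sub>F y in U. y \<in> \<Inter>\<A>))"

text \<open>
  HOL cannot quantify over types inside a formula, so ``for every cardinal \<open>k \<ge> l\<close>'' ranges over
  the cardinals on the type \<open>'k\<close>, which is a parameter. A strongly compact cardinal satisfies the
  predicate for every choice of \<open>'k\<close>.
\<close>

definition strongly_compact :: "'k itself \<Rightarrow> 'l rel \<Rightarrow> bool" where
  "strongly_compact (_ :: 'k itself) l \<longleftrightarrow>
     Card_order l \<and>
     (\<forall>k :: 'k rel. Card_order k \<and> l \<le>o k \<longrightarrow>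
        (\<exists>U. ultrafilter_on (subsets_of_size_less (Field k) l) U \<and> complete_filter l U \<and>
           (\<forall>x \<in> subsets_of_size_less (Field k) l.
              \<forall>\<^sub>F y in U. y \<in> {y \<in> subsets_of_size_less (Field k) l. x \<subseteq> y})))"

definition covering_matrix :: "'t rel \<Rightarrow> 'k rel \<Rightarrow> ('t \<Rightarrow> 'k \<Rightarrow> 'k set) \<Rightarrow> bool" where
  "covering_matrix t k K \<longleftrightarrow>
     (\<forall>a \<in> Field t. \<forall>b \<in> Field k. K a b \<subseteq> Field k) \<and>
     (\<forall>b \<in> Field k. underS k b \<subseteq> (\<Union>a \<in> Field t. K a b)) \<and>
     (\<forall>a \<in> Field t. \<forall>b \<in> Field k. |K a b| <o k) \<and>
     (\<forall>b \<in> Field k. \<forall>e \<in> Field t. \<forall>a \<in> underS t e. K a b \<subseteq> K e b) \<and>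
     (\<forall>b \<in> Field k. \<forall>c \<in> underS k b. \<forall>a \<in> Field t. \<exists>e \<in> Field t. K a c \<subseteq> K e b) \<and>
     (\<forall>X. X \<subseteq> Field k \<and> |X| \<le>o t \<longrightarrow>
        (\<exists>c \<in> Field k. \<forall>b \<in> Field k. \<forall>e \<in> Field t. \<exists>a \<in> Field t. K e b \<inter> X \<subseteq> K a c))"

definition covered_by :: "'k set set \<Rightarrow> 't rel \<Rightarrow> 'k rel \<Rightarrow> ('t \<Rightarrow> 'k \<Rightarrow> 'k set) \<Rightarrow> bool" where
  "covered_by \<X> t k K \<longleftrightarrow> (\<forall>X \<in> \<X>. \<exists>a \<in> Field t. \<exists>b \<in> Field k. X \<subseteq> K a b)"

text \<open>The library's \<open>cofinal A k\<close> is unboundedness of \<open>A\<close> (with strict upper elements).\<close>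

definition CP :: "'k rel \<Rightarrow> 't rel \<Rightarrow> bool" where
  "CP k t \<longleftrightarrow>
     (\<forall>K. covering_matrix t k K \<longrightarrow>
        (\<exists>A \<subseteq> Field k. cofinal A k \<and> covered_by (subsets_of_size A t) t k K))"

end

theory Submission
  imports Defs
begin

text \<open>
  For \<open>y\<close> of size \<open>< l\<close> in \<open>k\<close> let \<open>f y < k\<close> be a strict upper bound. Almost every \<open>y\<close> contains
  \<open>b\<close>, so that \<open>b < f y\<close> and \<open>b\<close> lies in some \<open>K a (f y)\<close>; by completeness of the ultrafilter one
  index \<open>a = h b\<close> works for almost every \<open>y\<close>. By regularity of \<open>k\<close> the function \<open>h\<close> is constant,
  with value \<open>a\<close>, on an unbounded set \<open>A\<close>. If \<open>X \<subseteq> A\<close> has size \<open>t < l\<close>, completeness gives a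
  single \<open>y\<close> with \<open>X \<subseteq> K a (f y)\<close>.
\<close>

text \<open>Regularity keeps \<open>A\<close> from being cofinal, and since an infinite cardinal has
  no greatest element, the resulting bound can be made strict.\<close>

lemma regular_cardinal_bounded:
  assumes k: "regular_cardinal k" and "A \<subseteq> Field k" "|A| <o k"
  obtains a where "a \<in> Field k" "A \<subseteq> underS k a"
proof -
  have "Card_order k" and inf: "\<not> finite (Field k)" and reg: "regularCard k"
    using k unfolding regular_cardinal_def cinfinite_def by auto
  then have wo: "Well_order k" by (auto simp: card_order_on_def)
  have "\<not> cofinal A k"
    using reg assms(2,3) not_ordLess_ordIso unfolding regularCard_def by blast
  \<comment> \<open>Negating \<open>cofinal\<close> gives a \<open>c\<close> with nothing of
    \<open>A\<close> strictly above it; by totality it is a weak upper bound, possibly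
    attained.\<close>
  then obtain c where c: "c \<in> Field k" "\<And>b. b \<in> A \<Longrightarrow> c = b \<or> (c, b) \<notin> k"
    unfolding cofinal_def by blast
  obtain a where a: "a \<in> Field k" "c \<noteq> a" "(c, a) \<in> k"
    using infinite_Card_order_limit[OF \<open>Card_order k\<close> inf c(1)] by blast
  have "trans k" "antisym k" "total_on (Field k) k" "refl_on (Field k) k"
    using wo unfolding order_on_defs by auto
  have "b \<in> underS k a" if "b \<in> A" for b
  proof -
    have "(b, c) \<in> k"
      using c(2)[OF that] c(1) that assms(2) \<open>total_on (Field k) k\<close> \<open>refl_on (Field k) k\<close>
      unfolding total_on_def refl_on_def by (metis subsetD)
    then have "(b, a) \<in> k" "b \<noteq> a"
      using a \<open>trans k\<close> \<open>antisym k\<close> unfolding trans_def antisym_def by blast+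
    then show ?thesis by (simp add: underS_def)
  qed
  with a(1) that show ?thesis by blast
qed

text \<open>Pigeonhole: if every fibre over \<open>T\<close> were bounded, there would be fewer than
  \<open>k\<close> chosen bounds, and regularity would put one \<open>c\<close> strictly above them
  all, although \<open>c\<close> lies in a fibre itself.\<close>

lemma regular_cardinal_cofinal_fibre:
  assumes k: "regular_cardinal k" and small: "|T| <o k" and h: "h ` Field k \<subseteq> T"
  obtains a where "a \<in> T" "cofinal {b \<in> Field k. h b = a} k"
proof -
  have "\<exists>a\<in>T. cofinal {b \<in> Field k. h b = a} k"
  proof (rule ccontr)
    assume "\<not> ?thesis"
    then have "\<forall>a\<in>T. \<exists>c. c \<in> Field k \<and> (\<forall>b\<in>Field k. h b = a \<longrightarrow> c = b \<or> (c, b) \<notin> k)"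
      by (simp add: cofinal_def) fast
    from bchoice[OF this] obtain g where g: "\<And>a. a \<in> T \<Longrightarrow> g a \<in> Field k"
      "\<And>a b. a \<in> T \<Longrightarrow> b \<in> Field k \<Longrightarrow> h b = a \<Longrightarrow> g a = b \<or> (g a, b) \<notin> k"
      by fast
    have "|g ` T| <o k"
      using card_of_image small by (rule ordLeq_ordLess_trans)
    then obtain c where c: "c \<in> Field k" "g ` T \<subseteq> underS k c"
      using regular_cardinal_bounded[OF k] g(1) by blast
    \<comment> \<open>As \<open>c\<close> belongs to the fibre over \<open>h c\<close>, its bound
      \<open>g (h c)\<close> cannot be strictly below \<open>c\<close>, contrary to the choice of
      \<open>c\<close>.\<close>
    have "h c \<in> T" using h c(1) by blast
    then have "g (h c) \<in> underS k c" "g (h c) = c \<or> (g (h c), c) \<notin> k"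
      using c g(2)[of "h c" c] by blast+
    then show False by (simp add: underS_def)
  qed
  with that show ?thesis by blast
qed

lemma complete_filter_ball:
  assumes U: "complete_filter l U" and I: "|I| <o l"
    and ev: "\<And>i. i \<in> I \<Longrightarrow> \<forall>\<^sub>F y in U. P i y"
  shows "\<forall>\<^sub>F y in U. \<forall>i\<in>I. P i y"
proof -
  let ?\<A> = "(\<lambda>i. {y. P i y}) ` I"
  have "|?\<A>| <o l"
    using card_of_image I by (rule ordLeq_ordLess_trans)
  with U ev have "\<forall>\<^sub>F y in U. y \<in> \<Inter>?\<A>"
    unfolding complete_filter_def by fastforce
  then show ?thesis by simp
qed

text \<open>Cutting \<open>P\<close> down to \<open>S\<close> brings it under the dichotomy, which
  speaks only of subsets of \<open>S\<close>.\<close>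

lemma ultrafilter_on_eventually_or:
  assumes "ultrafilter_on S U"
  shows "(\<forall>\<^sub>F y in U. P y) \<or> (\<forall>\<^sub>F y in U. \<not> P y)"
proof -
  have "\<forall>A. A \<subseteq> S \<longrightarrow> (\<forall>\<^sub>F y in U. y \<in> A) \<or> (\<forall>\<^sub>F y in U. y \<in> S - A)"
    using assms unfolding ultrafilter_on_def by (elim conjE)
  from this[rule_format, of "{y \<in> S. P y}"]
  have "(\<forall>\<^sub>F y in U. y \<in> {y \<in> S. P y}) \<or> (\<forall>\<^sub>F y in U. y \<in> S - {y \<in> S. P y})"
    by simp
  then show ?thesis
    by (elim disj_forward eventually_mono) simp_all
qed

text \<open>The dual of completeness: if no single \<open>P i\<close> held almost everywhere, all
  their negations would, hence so would the conjunction of fewer than \<open>l\<close> of them,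
  contradicting \<open>ev\<close>.\<close>

lemma complete_ultrafilter_eventually_bex:
  assumes U: "ultrafilter_on S U" "complete_filter l U" and I: "|I| <o l"
    and ev: "\<forall>\<^sub>F y in U. \<exists>i\<in>I. P i y"
  shows "\<exists>i\<in>I. \<forall>\<^sub>F y in U. P i y"
proof (rule ccontr)
  assume "\<not> ?thesis"
  then have "\<forall>\<^sub>F y in U. \<not> P i y" if "i \<in> I" for i
    using ultrafilter_on_eventually_or[OF U(1)] that by blast
  then have "\<forall>\<^sub>F y in U. \<forall>i\<in>I. \<not> P i y"
    by (rule complete_filter_ball[OF U(2) I])
  with ev have "\<forall>\<^sub>F y in U. False"
    by eventually_elim blast
  with U(1) show False
    by (simp add: ultrafilter_on_def trivial_limit_def)
qed

theorem mainTheorem1: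
  fixes l :: "'l rel"
  assumes "strongly_compact TYPE('k) l"
  shows "\<forall>(t :: 't rel) (k :: 'k rel).
    regular_cardinal t \<and> t <o l \<and> regular_cardinal k \<and> l \<le>o k \<longrightarrow> CP k t"
proof (intro allI impI)
  fix t :: "'t rel" and k :: "'k rel"
  assume "regular_cardinal t \<and> t <o l \<and> regular_cardinal k \<and> l \<le>o k"
  then have t: "regular_cardinal t" and tl: "t <o l" and k: "regular_cardinal k" and lk: "l \<le>o k"
    by auto
  have ck: "Card_order k" and ct: "Card_order t"
    using k t unfolding regular_cardinal_def by auto
  have Tl: "|Field t| <o l"
    using card_of_Field_ordIso[OF ct] tl by (rule ordIso_ordLess_trans)
  then have Tk: "|Field t| <o k" using lk by (rule ordLess_ordLeq_trans)
  define S where "S = subsets_of_size_less (Field k) l"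
  have "\<exists>U. ultrafilter_on S U \<and> complete_filter l U \<and>
      (\<forall>x\<in>S. \<forall>\<^sub>F y in U. y \<in> {y \<in> S. x \<subseteq> y})"
    using assms ck lk by (simp only: strongly_compact_def S_def)
  then obtain U where U: "ultrafilter_on S U" "complete_filter l U"
    and fine: "\<And>x. x \<in> S \<Longrightarrow> \<forall>\<^sub>F y in U. y \<in> {y \<in> S. x \<subseteq> y}"
    by (elim exE conjE) (rule that, assumption+, erule bspec)
  \<comment> \<open>Members of \<open>S\<close> have size below \<open>l \<le>o k\<close>, so
    regularity of \<open>k\<close> bounds them.\<close>
  have "\<exists>a\<in>Field k. y \<subseteq> underS k a" if "y \<in> S" for y
  proof -
    have "y \<subseteq> Field k" "|y| <o k"
      using that lk ordLess_ordLeq_trans by (auto simp: S_def subsets_of_size_less_def)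
    then show ?thesis by (rule regular_cardinal_bounded[OF k]) (rule bexI)
  qed
  then obtain f where f: "\<And>y. y \<in> S \<Longrightarrow> f y \<in> Field k" "\<And>y. y \<in> S \<Longrightarrow> y \<subseteq> underS k (f y)"
    by metis
  show "CP k t"
    unfolding CP_def
  proof (intro allI impI)
    fix K assume "covering_matrix t k K"
    then have cover: "\<And>b. b \<in> Field k \<Longrightarrow> underS k b \<subseteq> (\<Union>a\<in>Field t. K a b)"
      unfolding covering_matrix_def by (elim conjE) (rule bspec)
    have "\<exists>a\<in>Field t. \<forall>\<^sub>F y in U. y \<in> S \<and> b \<in> K a (f y)" if b: "b \<in> Field k" for b
    proof (rule complete_ultrafilter_eventually_bex[OF U Tl])
      \<comment> \<open>Infinity of \<open>t\<close> places the singleton \<open>{b}\<close> below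
        \<open>t\<close>, hence below \<open>l\<close>, so that fineness applies to it.\<close>
      have "cinfinite t" using t unfolding regular_cardinal_def by blast
      then have "|{b}| <o |Field t|"
        by (intro finite_ordLess_infinite card_of_Well_order)
          (simp_all add: cinfinite_def Field_card_of)
      then have "|{b}| <o l" using Tl by (rule ordLess_transitive)
      with b have "{b} \<in> S" unfolding S_def subsets_of_size_less_def by blast
      from fine[OF this] show "\<forall>\<^sub>F y in U. \<exists>a\<in>Field t. y \<in> S \<and> b \<in> K a (f y)"
      proof (rule eventually_mono)
        fix y assume "y \<in> {y \<in> S. {b} \<subseteq> y}"
        then have "y \<in> S" "b \<in> y" by simp_all
        then have "b \<in> (\<Union>a\<in>Field t. K a (f y))"
          using f cover by (meson subsetD)
        with \<open>y \<in> S\<close> show "\<exists>a\<in>Field t. y \<in> S \<and> b \<in> K a (f y)" by simp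
      qed
    qed
    then have "\<forall>b\<in>Field k. \<exists>a. a \<in> Field t \<and> (\<forall>\<^sub>F y in U. y \<in> S \<and> b \<in> K a (f y))"
      by (simp add: Bex_def)
    from bchoice[OF this] obtain h where h: "\<And>b. b \<in> Field k \<Longrightarrow> h b \<in> Field t"
      "\<And>b. b \<in> Field k \<Longrightarrow> \<forall>\<^sub>F y in U. y \<in> S \<and> b \<in> K (h b) (f y)"
      by fast
    have "h ` Field k \<subseteq> Field t" using h(1) by (rule image_subsetI)
    then obtain a where a: "a \<in> Field t" and cof: "cofinal {b \<in> Field k. h b = a} k"
      by (rule regular_cardinal_cofinal_fibre[OF k Tk])
    have "\<exists>b\<in>Field k. X \<subseteq> K a b" if X: "X \<subseteq> {b \<in> Field k. h b = a}" "|X| =o t" for X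
    proof -
      have Xl: "|X| <o l" using X(2) tl by (rule ordIso_ordLess_trans)
      have "X \<in> S" using X Xl unfolding S_def subsets_of_size_less_def by blast
      have "\<forall>\<^sub>F y in U. y \<in> S \<and> b \<in> K a (f y)" if "b \<in> X" for b
        using h(2)[of b] X(1) that by auto
      then have "\<forall>\<^sub>F y in U. \<forall>b\<in>X. y \<in> S \<and> b \<in> K a (f y)"
        by (rule complete_filter_ball[OF U(2) Xl])
      \<comment> \<open>The quantifier over \<open>X\<close> yields \<open>y \<in> S\<close> only
        for nonempty \<open>X\<close>; fineness at \<open>X\<close> yields it outright.\<close>
      with fine[OF \<open>X \<in> S\<close>] have "\<forall>\<^sub>F y in U. y \<in> S \<and> X \<subseteq> K a (f y)"
        by eventually_elim blast
      \<comment> \<open>Properness of \<open>U\<close> turns almost every \<open>y\<close> into an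
        actual one, and \<open>f y\<close> is the required column; \<open>y \<in> S\<close> puts it
        in \<open>Field k\<close>.\<close>
      moreover have "U \<noteq> bot" using U(1) by (simp add: ultrafilter_on_def)
      ultimately have "\<exists>y. y \<in> S \<and> X \<subseteq> K a (f y)"
        by (rule eventually_happens'[rotated])
      with f(1) show ?thesis by fast
    qed
    with a have "covered_by (subsets_of_size {b \<in> Field k. h b = a} t) t k K"
      unfolding covered_by_def subsets_of_size_def by blast
    with cof show "\<exists>A\<subseteq>Field k. cofinal A k \<and> covered_by (subsets_of_size A t) t k K"
      by (intro exI[of _ "{b \<in> Field k. h b = a}"] conjI) (rule Collect_restrict)
  qed
qed

end
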